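(* Let $N$ be a positive integer, let $c \in \mathbb{Q}$, and let $\phi_c(z) = z^2 + c$. Let $K$ be a finite Galois extension of $\mathbb{Q}$ of degree $d = [K:\mathbb{Q}]$, and let $g = \gcd(N, d)$. Let $(z_0, \dots, z_{N-1})$ be an exact $N$-cycle of $\phi_c$ with all $z_j \in K$ and $\phi_c(z_j) = z_{j+1}$ for all $j \in \mathbb{Z}/N\mathbb{Z}$. Then exactly one of the following holds: (i) there exist $m \in \mathbb{Z}/g\mathbb{Z}$ and a nontrivial $\tau \in \mathrm{Gal}(K/\mathbb{Q})$ such that $z_{m \cdot \frac{N}{g}} = \tau(z_0)$; (ii) for every nontrivial $\tau \in \mathrm{Gal}(K/\mathbb{Q})$, $\{z_0, \dots, z_{N-1}\} \cap \{\tau(z_0), \dots, \tau(z_{N-1})\} = \emptyset$.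
   Context: For a map $\phi$, $\phi^n$ denotes its $n$-th iterate. A point $z$ is a periodic point of period $N$ of $\phi$ if $\phi^N(z) = z$; its orbit $(z, \phi(z), \dots, \phi^{N-1}(z))$ is an $N$-cycle. It is an exact $N$-cycle (and $z$ has exact period $N$) if $\phi(z), \dots, \phi^{N-1}(z)$ are all distinct from $z$. Indices of the cycle are taken modulo $N$. *)

theory Defs
  imports Complex_Main "HOL-Library.FuncSet" "HOL-Computational_Algebra.Computational_Algebra"
begin

definition periodic_point :: "('a \<Rightarrow> 'a) \<Rightarrow> nat \<Rightarrow> 'a \<Rightarrow> bool" where
  "periodic_point f N x \<longleftrightarrow> (f ^^ N) x = x"

definition exact_period :: "('a \<Rightarrow> 'a) \<Rightarrow> nat \<Rightarrow> 'a \<Rightarrow> bool" where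
  "exact_period f N x \<longleftrightarrow> periodic_point f N x \<and> (\<forall>n\<in>{1..<N}. (f ^^ n) x \<noteq> x)"

text \<open>A cycle is given by a function on the natural numbers of which only the values at
  the representatives \<open>0, \<dots>, N - 1\<close> of the residues modulo \<open>N\<close> are meaningful.\<close>

definition exact_cycle :: "('a \<Rightarrow> 'a) \<Rightarrow> nat \<Rightarrow> (nat \<Rightarrow> 'a) \<Rightarrow> bool" where
  "exact_cycle f N z \<longleftrightarrow> exact_period f N (z 0) \<and> (\<forall>j<N. z j = (f ^^ j) (z 0))"

definition quad_map :: "rat \<Rightarrow> 'a::field_char_0 \<Rightarrow> 'a" where
  "quad_map c z = z\<^sup>2 + of_rat c"

text \<open>A field extension of the rationals is a subfield \<open>K\<close> of an arbitrary ambient field of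
  characteristic 0; \<open>K\<close> may be the whole ambient type. The copy of the rationals inside \<open>K\<close>
  is the set \<open>\<rat>\<close>, that is, the range of \<open>of_rat\<close>.\<close>

definition subfield_of_type :: "'a::field set \<Rightarrow> bool" where
  "subfield_of_type K \<longleftrightarrow> 1 \<in> K \<and> (\<forall>x\<in>K. \<forall>y\<in>K. x - y \<in> K \<and> x * y \<in> K) \<and>
     (\<forall>x\<in>K. inverse x \<in> K)"

definition rat_scale :: "rat \<Rightarrow> 'a::field_char_0 \<Rightarrow> 'a" where
  "rat_scale q x = of_rat q * x"

lemma vector_space_rat_scale: "vector_space (rat_scale :: rat \<Rightarrow> 'a::field_char_0 \<Rightarrow> 'a)"
  by unfold_locales (simp_all add: rat_scale_def of_rat_add of_rat_mult algebra_simps)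

definition rat_degree :: "'a::field_char_0 set \<Rightarrow> nat" where
  "rat_degree K = vector_space.dim rat_scale K"

definition finite_over_rat :: "'a::field_char_0 set \<Rightarrow> bool" where
  "finite_over_rat K \<longleftrightarrow> (\<exists>B. finite B \<and> module.span rat_scale B = K)"

definition normal_over_rat :: "'a::field_char_0 set \<Rightarrow> bool" where
  "normal_over_rat K \<longleftrightarrow>
     (\<forall>p :: rat poly. irreducible p \<longrightarrow> (\<exists>x\<in>K. poly (map_poly of_rat p) x = 0) \<longrightarrow>
        (\<exists>xs. set xs \<subseteq> K \<and>
           map_poly of_rat p = smult (of_rat (lead_coeff p)) (\<Prod>x\<leftarrow>xs. [:- x, 1:])))"

text \<open>Minimal polynomials of elements of \<open>K\<close> have no multiple roots in an algebraically closed
  field containing the rationals, here taken to be the complex numbers.\<close>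

definition separable_over_rat :: "'a::field_char_0 set \<Rightarrow> bool" where
  "separable_over_rat K \<longleftrightarrow>
     (\<forall>p :: rat poly. irreducible p \<longrightarrow> (\<exists>x\<in>K. poly (map_poly of_rat p) x = 0) \<longrightarrow>
        rsquarefree (map_poly of_rat p :: complex poly))"

definition finite_galois_over_rat :: "'a::field_char_0 set \<Rightarrow> bool" where
  "finite_galois_over_rat K \<longleftrightarrow>
     subfield_of_type K \<and> finite_over_rat K \<and> normal_over_rat K \<and> separable_over_rat K"

text \<open>Automorphisms are normalised to be undefined outside \<open>K\<close>, so that each field automorphism
  is represented by exactly one function; the trivial one is \<open>\<lambda>x\<in>K. x\<close>.\<close>

definition Gal_rat :: "'a::field_char_0 set \<Rightarrow> ('a \<Rightarrow> 'a) set" where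
  "Gal_rat K = {\<tau> \<in> extensional K. bij_betw \<tau> K K \<and>
     (\<forall>x\<in>K. \<forall>y\<in>K. \<tau> (x + y) = \<tau> x + \<tau> y \<and> \<tau> (x * y) = \<tau> x * \<tau> y) \<and>
     (\<forall>q. \<tau> (of_rat q) = of_rat q)}"

end

theory Submission
  imports Defs "HOL-Computational_Algebra.Field_as_Ring"
begin

text \<open>If a Galois conjugate of some \<open>z\<^sub>j\<close> lies on the cycle, then \<open>\<tau>(z\<^sub>0) = z\<^sub>k = \<phi>\<^sup>k(z\<^sub>0)\<close> for some \<open>k\<close>.
  Hence \<open>\<phi>\<^sup>k\<close> acts on the roots of the minimal polynomial \<open>p\<close> of \<open>z\<^sub>0\<close>, and each of its orbits has
  exactly \<open>N / gcd(N, k)\<close> elements. Therefore \<open>N / gcd(N, k)\<close> divides the number \<open>deg p\<close> of roots,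
  which divides \<open>d\<close>. This means that \<open>N\<close> divides \<open>k d\<close>, that is, \<open>k\<close> is a multiple of \<open>N / g\<close>.\<close>

section \<open>Evaluation of rational polynomials at field elements\<close>

text \<open>Named as a ring homomorphism in its own right, so that later arguments use only its
  homomorphism laws and rarely touch coefficient embeddings.\<close>

definition rat_poly_eval :: "rat poly \<Rightarrow> 'a::field_char_0 \<Rightarrow> 'a" where
  "rat_poly_eval q x = poly (map_poly of_rat q) x"

lemma rat_poly_eval_0 [simp]: "rat_poly_eval 0 x = 0"
  by (simp add: rat_poly_eval_def)

lemma rat_poly_eval_1 [simp]: "rat_poly_eval 1 x = 1"
  by (simp add: rat_poly_eval_def)

lemma rat_poly_eval_pCons [simp]:
  "rat_poly_eval (pCons a q) x = of_rat a + x * rat_poly_eval q x"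
  by (simp add: rat_poly_eval_def map_poly_pCons)

lemma rat_poly_eval_add [simp]:
  "rat_poly_eval (p + q) x = rat_poly_eval p x + rat_poly_eval q x"
  by (induction p q rule: poly_induct2) (simp_all add: of_rat_add algebra_simps)

lemma rat_poly_eval_smult [simp]:
  "rat_poly_eval (smult a q) x = of_rat a * rat_poly_eval q x"
  by (induction q) (simp_all add: of_rat_mult algebra_simps)

lemma rat_poly_eval_mult [simp]:
  "rat_poly_eval (p * q) x = rat_poly_eval p x * rat_poly_eval q x"
  by (induction p) (simp_all add: algebra_simps)

lemma rat_poly_eval_diff [simp]:
  "rat_poly_eval (p - q) x = rat_poly_eval p x - rat_poly_eval q x"
  using rat_poly_eval_add[of "p - q" q x] by simp

lemma rat_poly_eval_monom [simp]:
  "rat_poly_eval (monom a n) x = of_rat a * x ^ n"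
  by (simp add: rat_poly_eval_def map_poly_monom poly_monom)

lemma rat_poly_eval_pcompose [simp]:
  "rat_poly_eval (pcompose p q) x = rat_poly_eval p (rat_poly_eval q x)"
  by (induction p) (simp_all add: pcompose_pCons)

lemma rat_poly_eval_eq_sum:
  assumes "\<forall>j\<ge>n. coeff q j = 0"
  shows "rat_poly_eval q x = (\<Sum>j<n. of_rat (coeff q j) * x ^ j)"
proof -
  have "rat_poly_eval q x = (\<Sum>j\<le>degree q. of_rat (coeff q j) * x ^ j)"
    by (simp add: rat_poly_eval_def poly_altdef coeff_map_poly degree_map_poly)
  also have "\<dots> = (\<Sum>j<n. of_rat (coeff q j) * x ^ j)"
  proof (rule sum.mono_neutral_cong)
    fix i assume "i \<in> {..<n} - {..degree q}"
    then show "of_rat (coeff q i) * x ^ i = 0"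
      by (simp add: coeff_eq_0)
  next
    fix i assume "i \<in> {..degree q} - {..<n}"
    then show "of_rat (coeff q i) * x ^ i = 0"
      using assms by simp
  qed auto
  finally show ?thesis .
qed

lemma pderiv_map_poly_of_rat:
  "pderiv (map_poly of_rat p) = (map_poly of_rat (pderiv p) :: 'a::field_char_0 poly)"
  by (rule poly_eqI) (simp add: coeff_pderiv coeff_map_poly of_rat_mult of_rat_add)

section \<open>Irreducible polynomials and their roots\<close>

text \<open>An irreducible polynomial over a field is prime, hence coprime to whatever it does not
  divide. Evaluated at a root of \<open>p\<close>, the identity makes \<open>v\<close> give the
  inverse of the value of \<open>q\<close>.\<close>

lemma irreducible_rat_poly_bezout:
  fixes p q :: "rat poly"
  assumes "irreducible p" "\<not> p dvd q"
  obtains u v where "u * p + v * q = 1"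
proof -
  have "prime_elem p"
    using assms(1) by (rule field_poly_irreducible_imp_prime)
  then have "coprime p q"
    using assms(2) by (rule prime_elem_imp_coprime)
  then have "gcd p q = 1"
    by simp
  then show thesis
    using bezout_coefficients_fst_snd[of p q] that by metis
qed

text \<open>Up to a scalar, \<open>p\<close> is the minimal polynomial of \<open>x\<close>: if
  \<open>p\<close> did not divide \<open>q\<close>, the Bezout identity evaluated at
  \<open>x\<close> would read \<open>0 = 1\<close>.\<close>

lemma rat_poly_eval_eq_0_iff_dvd:
  assumes "irreducible p" "rat_poly_eval p x = 0"
  shows "rat_poly_eval q x = 0 \<longleftrightarrow> p dvd q"
proof
  assume q: "rat_poly_eval q x = 0"
  show "p dvd q"
  proof (rule ccontr)
    assume "\<not> p dvd q"
    then obtain u v where "u * p + v * q = 1"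
      using irreducible_rat_poly_bezout assms(1) by metis
    then have "rat_poly_eval (u * p + v * q) x = 1"
      by simp
    then show False
      using q assms(2) by simp
  qed
qed (use assms(2) in \<open>auto elim!: dvdE\<close>)

text \<open>A repeated root is shared with the derivative, so \<open>p\<close> would divide
  \<open>pderiv p\<close>. In characteristic 0 this is impossible for nonconstant
  \<open>p\<close>.\<close>

lemma distinct_roots_irreducible_rat_poly:
  fixes xs :: "'a::field_char_0 list"
  assumes "irreducible p" and "map_poly of_rat p = smult a (\<Prod>x\<leftarrow>xs. [:- x, 1:])"
  shows "distinct xs"
proof (rule ccontr)
  assume "\<not> distinct xs"
  then obtain as y bs cs where xs: "xs = as @ [y] @ bs @ [y] @ cs"
    using not_distinct_decomp by blast
  let ?f = "\<lambda>ys. \<Prod>x\<leftarrow>ys. [:- x, 1:]"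
  \<comment> \<open>One factor is kept in front of the other, so that the product rule visibly
    leaves a factor vanishing at \<open>y\<close> in each summand.\<close>
  have P: "map_poly of_rat p = [:- y, 1:] * ([:- y, 1:] * smult a (?f as * ?f bs * ?f cs))"
    unfolding assms(2) xs by (simp add: mult_ac del: mult_pCons_left mult_pCons_right)
  have root: "rat_poly_eval p y = 0"
    unfolding rat_poly_eval_def P by simp
  have "rat_poly_eval (pderiv p) y = 0"
    unfolding rat_poly_eval_def pderiv_map_poly_of_rat[symmetric] P
    by (subst pderiv_mult) simp
  then have "p dvd pderiv p"
    using rat_poly_eval_eq_0_iff_dvd[OF assms(1) root] by simp
  moreover have "degree p \<noteq> 0"
    using assms(1) by (auto simp: irreducible_def is_unit_iff_degree)
  ultimately show False
    using not_dvd_pderiv by blast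
qed

section \<open>Degrees of elements and the dimension of the field\<close>

interpretation rat_vs: vector_space "rat_scale :: rat \<Rightarrow> 'a::field_char_0 \<Rightarrow> 'a"
  by (rule vector_space_rat_scale)

text \<open>Turns linear algebra into statements about polynomials. The bound is put on coefficients
  because \<open>degree q < n\<close> would exclude \<open>q = 0\<close> when
  \<open>n = 0\<close>.\<close>

lemma span_powers_mult:
  fixes x v :: "'a::field_char_0"
  shows "rat_vs.span ((\<lambda>j. x ^ j * v) ` {..<n}) =
    {rat_poly_eval q x * v | q. \<forall>j\<ge>n. coeff q j = 0}" (is "?S = ?T")
proof
  have "rat_vs.subspace ?T"
  proof (rule rat_vs.subspaceI)
    show "0 \<in> ?T"
      by (intro CollectI exI[of _ 0]) simp
  next
    fix a b assume "a \<in> ?T" "b \<in> ?T"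
    then obtain q r where "a = rat_poly_eval q x * v" "b = rat_poly_eval r x * v"
      "\<forall>j\<ge>n. coeff q j = 0" "\<forall>j\<ge>n. coeff r j = 0" by blast
    then show "a + b \<in> ?T"
      by (intro CollectI exI[of _ "q + r"]) (simp add: algebra_simps)
  next
    fix c a assume "a \<in> ?T"
    then obtain q where "a = rat_poly_eval q x * v" "\<forall>j\<ge>n. coeff q j = 0" by blast
    then show "rat_scale c a \<in> ?T"
      by (intro CollectI exI[of _ "smult c q"]) (simp add: rat_scale_def)
  qed
  moreover have "(\<lambda>j. x ^ j * v) ` {..<n} \<subseteq> ?T"
  proof clarify
    fix j assume "j < n"
    then show "\<exists>q. x ^ j * v = rat_poly_eval q x * v \<and> (\<forall>j\<ge>n. coeff q j = 0)"
      by (intro exI[of _ "monom 1 j"]) simp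
  qed
  ultimately show "?S \<subseteq> ?T"
    by (rule rat_vs.span_minimal[rotated])
next
  show "?T \<subseteq> ?S"
  proof clarify
    fix q :: "rat poly" assume "\<forall>j\<ge>n. coeff q j = 0"
    then have "rat_poly_eval q x * v = (\<Sum>j<n. rat_scale (coeff q j) (x ^ j * v))"
      by (simp add: rat_poly_eval_eq_sum rat_scale_def sum_distrib_right mult.assoc)
    also have "\<dots> \<in> ?S"
      by (intro rat_vs.span_sum rat_vs.span_scale rat_vs.span_base imageI)
    finally show "rat_poly_eval q x * v \<in> ?S" .
  qed
qed

text \<open>The powers are added one at a time. If \<open>x ^ n * v\<close> depended on the earlier
  vectors, a monic polynomial of degree \<open>n\<close> in \<open>x\<close> would carry
  \<open>v\<close> into the span of \<open>B\<close>.\<close>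

lemma independent_adjoin_powers:
  fixes x v :: "'a::field_char_0"
  assumes "rat_vs.independent B" "finite B"
    and "\<And>q. q \<noteq> 0 \<Longrightarrow> \<forall>j\<ge>n. coeff q j = 0 \<Longrightarrow> rat_poly_eval q x * v \<notin> rat_vs.span B"
  shows "rat_vs.independent (B \<union> (\<lambda>j. x ^ j * v) ` {..<n}) \<and>
    card (B \<union> (\<lambda>j. x ^ j * v) ` {..<n}) = card B + n"
  using assms(3)
proof (induction n)
  case 0
  then show ?case using assms(1) by simp
next
  case (Suc n)
  let ?C = "B \<union> (\<lambda>j. x ^ j * v) ` {..<n}"
  have IH: "rat_vs.independent ?C" "card ?C = card B + n"
    using Suc.IH Suc.prems by (meson Suc_leD)+
  have new: "x ^ n * v \<notin> rat_vs.span ?C"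
  proof
    assume "x ^ n * v \<in> rat_vs.span ?C"
    then obtain b q where b: "b \<in> rat_vs.span B" and q: "\<forall>j\<ge>n. coeff q j = 0"
      and eq: "x ^ n * v = b + rat_poly_eval q x * v"
      unfolding rat_vs.span_Un span_powers_mult by blast
    let ?r = "monom 1 n - q"
    have "coeff ?r n = 1"
      using q by simp
    then have "?r \<noteq> 0"
      by auto
    moreover have "\<forall>j\<ge>Suc n. coeff ?r j = 0"
      using q by simp
    moreover have "rat_poly_eval ?r x * v = b"
      using eq by (simp add: algebra_simps)
    ultimately show False
      using Suc.prems b by blast
  qed
  have "B \<union> (\<lambda>j. x ^ j * v) ` {..<Suc n} = insert (x ^ n * v) ?C"
    by (auto simp: lessThan_Suc)
  moreover have "x ^ n * v \<notin> ?C"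
    using new rat_vs.span_base[of "x ^ n * v" ?C] by argo
  moreover have "finite ?C"
    using assms(2) by simp
  ultimately show ?case
    using IH rat_vs.independent_insertI[OF new] by (simp only: card_insert_disjoint) simp
qed

text \<open>More powers of \<open>x\<close> than spanning vectors cannot be independent, so some
  nonzero polynomial vanishes at \<open>x\<close>; one of least degree is irreducible.\<close>

lemma algebraic_if_finite_over_rat:
  assumes "finite_over_rat K" "\<And>n. x ^ n \<in> K"
  obtains p where "irreducible p" "rat_poly_eval p x = 0"
proof -
  obtain B where B: "finite B" "rat_vs.span B = K"
    using assms(1) by (auto simp: finite_over_rat_def)
  have "\<exists>q. q \<noteq> 0 \<and> rat_poly_eval q x = 0"
  proof (rule ccontr)
    assume "\<nexists>q. q \<noteq> 0 \<and> rat_poly_eval q x = 0"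
    \<comment> \<open>Taking the empty set and \<open>v = 1\<close>, the hypothesis on polynomials
      says exactly that \<open>x\<close> is no root of a nonzero one.\<close>
    then have *: "rat_vs.independent ({} \<union> (\<lambda>j. x ^ j * 1) ` {..<Suc (card B)}) \<and>
        card ({} \<union> (\<lambda>j. x ^ j * 1) ` {..<Suc (card B)}) = card ({} :: 'a set) + Suc (card B)"
      by (intro independent_adjoin_powers) (auto simp: rat_vs.independent_empty)
    moreover have "(\<lambda>j. x ^ j * 1) ` {..<Suc (card B)} \<subseteq> rat_vs.span B"
      using B assms(2) by auto
    ultimately show False
      using rat_vs.independent_span_bound[OF B(1), of "(\<lambda>j. x ^ j * 1) ` {..<Suc (card B)}"]
      by simp
  qed
  then obtain p where p: "p \<noteq> 0" "rat_poly_eval p x = 0"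
    and min: "\<And>q. q \<noteq> 0 \<and> rat_poly_eval q x = 0 \<Longrightarrow> degree p \<le> degree q"
    using ex_has_least_nat[of "\<lambda>q. q \<noteq> 0 \<and> rat_poly_eval q x = 0" _ degree] by blast
  \<comment> \<open>By minimality the factor vanishing at \<open>x\<close> has full degree, which
    leaves degree 0 for the other.\<close>
  have unit: "is_unit b" if "p = a * b" "rat_poly_eval a x = 0" for a b
  proof -
    have "a \<noteq> 0" "b \<noteq> 0"
      using that p by auto
    then have "degree a + degree b \<le> degree a"
      using that min[of a] by (simp add: degree_mult_eq)
    then show ?thesis
      using \<open>b \<noteq> 0\<close> by (simp add: is_unit_iff_degree)
  qed
  have "irreducible p"
  proof (rule irreducibleI)
    show "\<not> is_unit p"
    proof
      assume "is_unit p"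
      then obtain w where "1 = p * w" by (rule dvdE)
      then have "rat_poly_eval p x * rat_poly_eval w x = 1"
        by (metis rat_poly_eval_mult rat_poly_eval_1)
      then show False using p by simp
    qed
    fix a b assume ab: "p = a * b"
    then have "rat_poly_eval a x = 0 \<or> rat_poly_eval b x = 0"
      using p by simp
    then show "is_unit a \<or> is_unit b"
      using unit ab mult.commute by metis
  qed (use p in simp)
  then show thesis
    using that p by blast
qed

text \<open>The tower law for the field generated by \<open>x\<close>, proved without constructing
  that field: a basis of \<open>K\<close> is assembled from blocks
  \<open>v, x v, ..., x^(n-1) v\<close> with \<open>n = degree p\<close>.\<close>

lemma degree_dvd_rat_degree:
  fixes K :: "'a::field_char_0 set"
  assumes K: "subfield_of_type K" "finite_over_rat K" and x: "x \<in> K"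
    and p: "irreducible p" "rat_poly_eval p x = 0"
  shows "degree p dvd rat_degree K"
proof -
  obtain F where F: "finite F" "rat_vs.span F = K"
    using K(2) by (auto simp: finite_over_rat_def)
  have K_mult: "a * b \<in> K" if "a \<in> K" "b \<in> K" for a b
    using K(1) that by (simp add: subfield_of_type_def)
  have K_power: "x ^ j \<in> K" for j
    using K(1) x K_mult by (induction j) (auto simp: subfield_of_type_def)
  \<comment> \<open>Closure under multiplication by \<open>x\<close> makes the span a vector space
    over the field generated by \<open>x\<close>. A largest such \<open>B\<close> exists because
    \<open>F\<close> bounds the size of independent subsets of \<open>K\<close>.\<close>
  define P where "P B \<longleftrightarrow> finite B \<and> rat_vs.independent B \<and> B \<subseteq> K \<and>
      (\<forall>b\<in>rat_vs.span B. x * b \<in> rat_vs.span B) \<and> degree p dvd card B" for B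
  have "P {}"
    by (simp add: P_def rat_vs.independent_empty)
  moreover have "\<forall>B. P B \<longrightarrow> card B < Suc (card F)"
    using rat_vs.independent_span_bound[OF F(1)] F(2) by (auto simp: P_def less_Suc_eq_le)
  ultimately obtain B where "P B" and max: "\<And>C. P C \<Longrightarrow> card C \<le> card B"
    using ex_has_greatest_nat[of P "{}" card "Suc (card F)"] by blast
  then have B: "finite B" "rat_vs.independent B" "B \<subseteq> K" "degree p dvd card B"
    and closed: "\<And>b. b \<in> rat_vs.span B \<Longrightarrow> x * b \<in> rat_vs.span B"
    by (auto simp: P_def)
  have closed_eval: "rat_poly_eval q x * b \<in> rat_vs.span B" if "b \<in> rat_vs.span B" for q b
  proof (induction q)
    case (pCons a q)
    have "rat_scale a b + x * (rat_poly_eval q x * b) \<in> rat_vs.span B"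
      using that pCons closed by (intro rat_vs.span_add rat_vs.span_scale)
    also have "rat_scale a b + x * (rat_poly_eval q x * b) = rat_poly_eval (pCons a q) x * b"
      by (simp add: rat_scale_def algebra_simps)
    finally show ?case .
  qed (simp add: rat_vs.span_zero)
  have deg: "degree p > 0"
    using p(1) by (auto simp: irreducible_def is_unit_iff_degree)
  have "K \<subseteq> rat_vs.span B"
  proof (rule ccontr)
    assume "\<not> K \<subseteq> rat_vs.span B"
    then obtain v where v: "v \<in> K" "v \<notin> rat_vs.span B" by blast
    let ?A = "(\<lambda>j. x ^ j * v) ` {..<degree p}"
    \<comment> \<open>The value of such a \<open>q\<close> at \<open>x\<close> has an inverse that
      is again a polynomial in \<open>x\<close>, so otherwise \<open>v\<close> itself would lie in
      the span.\<close>
    have "rat_poly_eval q x * v \<notin> rat_vs.span B"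
      if q: "q \<noteq> 0" "\<forall>j\<ge>degree p. coeff q j = 0" for q
    proof
      assume *: "rat_poly_eval q x * v \<in> rat_vs.span B"
      have "degree q < degree p"
        using q leading_coeff_0_iff not_le by blast
      then have "\<not> p dvd q"
        using q(1) dvd_imp_degree_le not_le by blast
      then obtain u w where "u * p + w * q = 1"
        using irreducible_rat_poly_bezout p(1) by metis
      then have "rat_poly_eval (u * p + w * q) x = 1"
        by simp
      then have "rat_poly_eval w x * (rat_poly_eval q x * v) = v"
        using p(2) by (simp flip: mult.assoc)
      then show False
        using closed_eval[OF *, of w] v(2) by metis
    qed
    then have indep: "rat_vs.independent (B \<union> ?A)" "card (B \<union> ?A) = card B + degree p"
      using independent_adjoin_powers[OF B(2,1)] by blast+
    have "x * b \<in> rat_vs.span (B \<union> ?A)" if "b \<in> rat_vs.span (B \<union> ?A)" for b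
    proof -
      obtain a q where a: "a \<in> rat_vs.span B" and b: "b = a + rat_poly_eval q x * v"
        using \<open>b \<in> _\<close> unfolding rat_vs.span_Un span_powers_mult by blast
      \<comment> \<open>Multiplying by \<open>x\<close> may raise the degree to
        \<open>degree p\<close>; reduction modulo \<open>p\<close> brings it back without changing
        the value at \<open>x\<close>.\<close>
      define r where "r = pCons 0 q mod p"
      have "rat_poly_eval (pCons 0 q div p * p + r) x = rat_poly_eval (pCons 0 q) x"
        unfolding r_def by (simp only: div_mult_mod_eq)
      then have "rat_poly_eval r x = x * rat_poly_eval q x"
        using p(2) by simp
      then have "x * b = x * a + rat_poly_eval r x * v"
        by (simp add: b algebra_simps)
      moreover have "\<forall>j\<ge>degree p. coeff r j = 0"
        using degree_mod_less[of p "pCons 0 q"] deg unfolding r_def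
        by (metis coeff_0 coeff_eq_0 degree_0 less_le_trans less_irrefl)
      ultimately show ?thesis
        using closed[OF a] unfolding rat_vs.span_Un span_powers_mult by blast
    qed
    moreover have "?A \<subseteq> K"
      using K_mult K_power v(1) by blast
    ultimately have "P (B \<union> ?A)"
      using B indep by (simp add: P_def)
    then show False
      using max indep(2) deg by fastforce
  qed
  then have "card B = rat_vs.dim K"
    using B by (intro rat_vs.basis_card_eq_dim)
  then show ?thesis
    using B(4) by (simp add: rat_degree_def)
qed

section \<open>Counting by orbits\<close>

text \<open>The orbits of \<open>f\<close> partition \<open>R\<close>, and each has exactly
  \<open>s\<close> elements.\<close>

lemma dvd_card_if_uniform_period:
  assumes "finite R" "f ` R \<subseteq> R" "s > 0"
    and period: "\<And>x t. x \<in> R \<Longrightarrow> (f ^^ t) x = x \<longleftrightarrow> s dvd t"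
  shows "s dvd card R"
proof -
  have in_R: "(f ^^ t) x \<in> R" if "x \<in> R" for x t
    using that assms(2) by (induction t) auto
  define r where "r = {(x, y). x \<in> R \<and> (\<exists>t. y = (f ^^ t) x)}"
  \<comment> \<open>Forward iteration can be undone by iterating further until the total is a
    multiple of \<open>s\<close>; this yields symmetry of \<open>r\<close>.\<close>
  have return: "(f ^^ (t * (s - 1))) ((f ^^ t) x) = x" if "x \<in> R" for x t
  proof -
    have "(f ^^ (t * (s - 1))) ((f ^^ t) x) = (f ^^ (t * (s - 1) + t)) x"
      by (simp add: funpow_add)
    also have "t * (s - 1) + t = t * s"
      using assms(3) by (cases s) auto
    finally show ?thesis
      using period[OF that, of "t * s"] by simp
  qed
  have "equiv R r"
  proof (rule equivI)
    show "r \<subseteq> R \<times> R"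
      using in_R by (auto simp: r_def)
    show "refl_on R r"
      using in_R by (auto simp: r_def refl_on_def intro: exI[of _ 0])
    show "sym r"
      by (rule symI) (auto simp: r_def in_R intro!: exI return[symmetric])
    show "trans r"
    proof (rule transI)
      fix x y w assume "(x, y) \<in> r" "(y, w) \<in> r"
      then obtain t u where "x \<in> R" "y = (f ^^ t) x" "w = (f ^^ u) y"
        by (auto simp: r_def)
      then have "w = (f ^^ (u + t)) x"
        by (simp add: funpow_add)
      then show "(x, w) \<in> r"
        using \<open>x \<in> R\<close> by (auto simp: r_def)
    qed
  qed
  moreover have "s dvd card X" if "X \<in> R // r" for X
  proof -
    obtain x where x: "x \<in> R" and X: "X = {(f ^^ t) x | t. True}"
      using \<open>X \<in> R // r\<close> by (fastforce simp: quotient_def r_def)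
    have "(f ^^ t) x \<in> (\<lambda>t. (f ^^ t) x) ` {..<s}" for t
      using funpow_mod_eq[of s f x t] period[OF x, of s] assms(3)
      by (intro image_eqI[of _ _ "t mod s"]) simp_all
    then have "X = (\<lambda>t. (f ^^ t) x) ` {..<s}"
      using X by blast
    moreover have "inj_on (\<lambda>t. (f ^^ t) x) {..<s}"
    proof (rule linorder_inj_onI)
      fix i j assume ij: "i < j" "i \<in> {..<s}" "j \<in> {..<s}"
      show "(f ^^ i) x \<noteq> (f ^^ j) x"
      proof
        assume eq: "(f ^^ i) x = (f ^^ j) x"
        \<comment> \<open>Applying \<open>f ^^ (s - i)\<close> to both sides closes the orbit on the
          left and makes \<open>s + (j - i)\<close> a period of \<open>x\<close> on the
          right.\<close>
        have "x = (f ^^ (s - i + i)) x"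
          using ij period[OF x, of s] by simp
        also have "\<dots> = (f ^^ (s - i)) ((f ^^ i) x)"
          unfolding funpow_add by simp
        also have "\<dots> = (f ^^ (s - i + j)) x"
          unfolding eq funpow_add by simp
        also have "s - i + j = s + (j - i)"
          using ij by simp
        finally have "s dvd s + (j - i)"
          using period[OF x] by metis
        then have "s dvd j - i"
          by simp
        then show False
          using ij by (auto dest!: dvd_imp_le)
      qed
    qed auto
    ultimately show ?thesis
      by (simp add: card_image)
  qed
  ultimately show ?thesis
    using assms(1) equiv_imp_dvd_card by blast
qed

section \<open>Periods of the quadratic map on conjugate points\<close>

lemma exact_period_funpow_eq_iff:
  assumes "exact_period f N x" "N > 0"
  shows "(f ^^ t) x = x \<longleftrightarrow> N dvd t"
proof -
  have "(f ^^ (t mod N)) x = (f ^^ t) x"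
    using assms(1) by (intro funpow_mod_eq) (simp add: exact_period_def periodic_point_def)
  moreover have "(f ^^ (t mod N)) x = x \<longleftrightarrow> t mod N = 0"
    using assms mod_less_divisor[of N t] by (force simp: exact_period_def Suc_le_eq)
  ultimately show ?thesis
    by (simp add: dvd_eq_mod_eq_0)
qed

text \<open>One rational polynomial serves for all points \<open>w\<close>. Thus statements about
  iterates can be moved between conjugates, and automorphisms commute with iteration.\<close>

lemma quad_map_funpow_is_rat_poly:
  "\<exists>Q. \<forall>w :: 'a::field_char_0. rat_poly_eval Q w = (quad_map c ^^ j) w"
proof (induction j)
  case 0
  show ?case
    by (rule exI[of _ "[:0, 1:]"]) simp
next
  case (Suc j)
  then obtain Q where Q: "\<And>w :: 'a. rat_poly_eval Q w = (quad_map c ^^ j) w"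
    by blast
  have "rat_poly_eval (Q * Q + [:c:]) w = (quad_map c ^^ Suc j) w" for w :: 'a
    by (simp add: quad_map_def[of c "(quad_map c ^^ j) w"] power2_eq_square Q)
  then show ?case
    by blast
qed

text \<open>A relation \<open>\<phi>\<^sup>j(x) = x\<close> is a polynomial identity over the rationals, so it passes to all
  conjugates of \<open>x\<close>; this makes the orbits on the roots equally long.\<close>

lemma period_dvd_mult_rat_degree:
  fixes K :: "'a::field_char_0 set"
  assumes K: "finite_galois_over_rat K" and "x \<in> K" "N > 0"
    and period: "exact_period (quad_map c) N x"
    and conj: "\<And>p. rat_poly_eval p x = 0 \<Longrightarrow> rat_poly_eval p ((quad_map c ^^ k) x) = 0"
  shows "N dvd k * rat_degree K"
proof -
  have sub: "subfield_of_type K" and fin: "finite_over_rat K" and nor: "normal_over_rat K"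
    using K by (auto simp: finite_galois_over_rat_def)
  have "x ^ n \<in> K" for n
    using sub \<open>x \<in> K\<close> by (induction n) (auto simp: subfield_of_type_def)
  then obtain p where p: "irreducible p" "rat_poly_eval p x = 0"
    using algebraic_if_finite_over_rat[OF fin] by blast
  then obtain xs where xs: "map_poly of_rat p =
      smult (of_rat (lead_coeff p)) (\<Prod>y\<leftarrow>xs. [:- (y :: 'a), 1:])"
    using nor \<open>x \<in> K\<close> unfolding normal_over_rat_def rat_poly_eval_def by blast
  have "p \<noteq> 0"
    using p(1) by auto
  have "degree (\<Prod>y\<leftarrow>ys. [:- y, 1:]) = length ys" for ys :: "'a list"
  proof (induction ys)
    case (Cons y ys)
    have "(\<Prod>y\<leftarrow>ys. [:- y, 1:]) \<noteq> 0"
      by (auto simp: prod_list_zero_iff)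
    then show ?case
      using Cons by (simp add: degree_mult_eq del: mult_pCons_left)
  qed simp
  then have "degree (map_poly of_rat p :: 'a poly) = length xs"
    using \<open>p \<noteq> 0\<close> unfolding xs by simp
  moreover have "distinct xs"
    using p(1) xs by (rule distinct_roots_irreducible_rat_poly)
  ultimately have card: "card (set xs) = degree p"
    by (simp add: degree_map_poly distinct_card)
  have roots: "y \<in> set xs \<longleftrightarrow> rat_poly_eval p y = 0" for y
  proof -
    have "poly (\<Prod>y\<leftarrow>ys. [:- y, 1:]) y = 0 \<longleftrightarrow> y \<in> set ys" for ys
      by (induction ys) auto
    then show ?thesis
      using \<open>p \<noteq> 0\<close> unfolding rat_poly_eval_def xs by simp
  qed
  \<comment> \<open>This is the exact period of \<open>x\<close> under the \<open>k\<close>-th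
    iterate, as cancelling \<open>gcd N k\<close> from \<open>N\<close> and \<open>k\<close>
    shows.\<close>
  define s where "s = N div gcd N k"
  have s_dvd: "N dvd k * t \<longleftrightarrow> s dvd t" for t
  proof -
    obtain a b where ab: "N = gcd N k * a" "k = gcd N k * b" "coprime a b"
      using gcd_coprime_exists[of N k] \<open>N > 0\<close> by (auto simp: mult.commute)
    have g: "gcd N k > 0"
      using \<open>N > 0\<close> by simp
    then have "s = a"
      using ab(1) unfolding s_def by (metis nonzero_mult_div_cancel_left not_gr_zero)
    have "N dvd k * t \<longleftrightarrow> gcd N k * a dvd gcd N k * (b * t)"
      using ab(1,2) by (metis mult.assoc)
    also have "\<dots> \<longleftrightarrow> a dvd t"
      using \<open>N > 0\<close> ab(3) by (simp add: coprime_dvd_mult_right_iff)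
    finally show ?thesis
      using \<open>s = a\<close> by simp
  qed
  \<comment> \<open>Every root of \<open>p\<close> has \<open>p\<close> as its minimal polynomial,
    so all of them satisfy the same rational equations.\<close>
  have transfer: "rat_poly_eval q y = 0 \<longleftrightarrow> rat_poly_eval q x = 0" if "y \<in> set xs" for q y
    using rat_poly_eval_eq_0_iff_dvd[OF p(1)] p(2) that roots by metis
  have "s dvd card (set xs)"
  proof (rule dvd_card_if_uniform_period)
    show "(quad_map c ^^ k) ` set xs \<subseteq> set xs"
    proof clarify
      fix y assume y: "y \<in> set xs"
      obtain Q where Q: "\<And>w :: 'a. rat_poly_eval Q w = (quad_map c ^^ k) w"
        using quad_map_funpow_is_rat_poly by blast
      \<comment> \<open>That the iterate of a point is a root of \<open>p\<close> is itself a
        rational equation on the point, hence moves from \<open>x\<close> to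
        \<open>y\<close>.\<close>
      have "rat_poly_eval (pcompose p Q) x = 0"
        using conj[OF p(2)] Q by simp
      then have "rat_poly_eval (pcompose p Q) y = 0"
        using transfer[OF y] by blast
      then show "(quad_map c ^^ k) y \<in> set xs"
        using roots Q by simp
    qed
  next
    fix y t assume y: "y \<in> set xs"
    obtain Q where Q: "\<And>w :: 'a. rat_poly_eval Q w = (quad_map c ^^ (k * t)) w"
      using quad_map_funpow_is_rat_poly by blast
    \<comment> \<open>Subtracting the polynomial \<open>[:0, 1:]\<close> turns being fixed into
      being a root.\<close>
    have "((quad_map c ^^ k) ^^ t) y = y \<longleftrightarrow> rat_poly_eval (Q - [:0, 1:]) y = 0"
      by (simp add: Q funpow_mult mult.commute)
    also have "\<dots> \<longleftrightarrow> rat_poly_eval (Q - [:0, 1:]) x = 0"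
      by (rule transfer[OF y])
    also have "\<dots> \<longleftrightarrow> (quad_map c ^^ (k * t)) x = x"
      by (simp add: Q)
    also have "\<dots> \<longleftrightarrow> s dvd t"
      using exact_period_funpow_eq_iff[OF period \<open>N > 0\<close>] s_dvd by blast
    finally show "((quad_map c ^^ k) ^^ t) y = y \<longleftrightarrow> s dvd t" .
  next
    show "s > 0"
      using \<open>N > 0\<close> by (simp add: s_def div_greater_zero_iff gcd_le1_nat)
  qed simp
  also have "card (set xs) dvd rat_degree K"
    unfolding card using degree_dvd_rat_degree[OF sub fin \<open>x \<in> K\<close> p] .
  finally show ?thesis
    using s_dvd by blast
qed

section \<open>Galois conjugates on the cycle\<close>

text \<open>Membership in \<open>K\<close> is carried through the induction because
  \<open>\<tau>\<close> is additive and multiplicative only there. Rational constants lie in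
  \<open>K\<close> as multiples of 1 in a rational span.\<close>

lemma Gal_rat_eval:
  assumes "\<tau> \<in> Gal_rat K" "subfield_of_type K" "finite_over_rat K" "x \<in> K"
  shows "rat_poly_eval q x \<in> K \<and> \<tau> (rat_poly_eval q x) = rat_poly_eval q (\<tau> x)"
proof (induction q)
  case 0
  have "0 \<in> K"
    using assms(2) unfolding subfield_of_type_def by (metis diff_self)
  moreover have "\<tau> (of_rat 0) = of_rat 0"
    using assms(1) unfolding Gal_rat_def by blast
  ultimately show ?case
    by simp
next
  case (pCons a q)
  obtain B where B: "rat_vs.span B = K"
    using assms(3) by (auto simp: finite_over_rat_def)
  have "1 \<in> K"
    using assms(2) by (simp add: subfield_of_type_def)
  then have "rat_scale a 1 \<in> K"
    using B rat_vs.span_scale by blast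
  then have a: "of_rat a \<in> K"
    by (simp add: rat_scale_def)
  have xq: "x * rat_poly_eval q x \<in> K"
    using assms(2,4) pCons by (simp add: subfield_of_type_def)
  have "of_rat a + x * rat_poly_eval q x \<in> K"
    using a xq B rat_vs.span_add by blast
  moreover have "\<tau> (of_rat a + x * rat_poly_eval q x) = of_rat a + \<tau> x * \<tau> (rat_poly_eval q x)"
    using assms(1,4) a xq pCons by (simp add: Gal_rat_def)
  ultimately show ?case
    using pCons by simp
qed

theorem theorem2p1:
  fixes N d g :: nat and c :: rat and K :: "'a::field_char_0 set" and z :: "nat \<Rightarrow> 'a"
  assumes "N > 0"
    and "finite_galois_over_rat K"
    and "d = rat_degree K"
    and "g = gcd N d"
    and "exact_cycle (quad_map c) N z"
    and "\<forall>j<N. z j \<in> K"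
    and "\<forall>j<N. quad_map c (z j) = z ((j + 1) mod N)"
  shows "(\<exists>m<g. \<exists>\<tau>\<in>Gal_rat K. \<tau> \<noteq> (\<lambda>x\<in>K. x) \<and> z (m * (N div g)) = \<tau> (z 0))
     \<longleftrightarrow> \<not> (\<forall>\<tau>\<in>Gal_rat K. \<tau> \<noteq> (\<lambda>x\<in>K. x) \<longrightarrow>
              z ` {..<N} \<inter> (\<lambda>j. \<tau> (z j)) ` {..<N} = {})"
proof -
  let ?f = "quad_map c :: 'a \<Rightarrow> 'a"
  have g: "g > 0" "g * (N div g) = N"
    using \<open>N > 0\<close> assms(4) by auto
  have sub: "subfield_of_type K" and fin: "finite_over_rat K"
    using assms(2) by (auto simp: finite_galois_over_rat_def)
  have ex: "exact_period ?f N (z 0)" and zj: "\<And>j. j < N \<Longrightarrow> z j = (?f ^^ j) (z 0)"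
    using assms(5) unfolding exact_cycle_def by blast+
  have fN: "(?f ^^ N) (z 0) = z 0"
    using ex by (simp add: exact_period_def periodic_point_def)
  have forward: "(?f ^^ t) (z j) = (?f ^^ (t + j)) (z 0)" if "j < N" for t j
    using zj[OF that] by (simp add: funpow_add)
  show ?thesis
  proof (intro iffI notI)
    assume "\<exists>m<g. \<exists>\<tau>\<in>Gal_rat K. \<tau> \<noteq> (\<lambda>x\<in>K. x) \<and> z (m * (N div g)) = \<tau> (z 0)"
    then obtain m \<tau> where m: "m < g" and \<tau>: "\<tau> \<in> Gal_rat K" "\<tau> \<noteq> (\<lambda>x\<in>K. x)"
      "z (m * (N div g)) = \<tau> (z 0)" by blast
    have "N div g > 0"
      using g \<open>N > 0\<close> by (metis gr0I mult_0_right)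
    \<comment> \<open>The bound matters since \<open>z\<close> is meaningful only below
      \<open>N\<close>.\<close>
    then have "m * (N div g) < N"
      using m g(2) by (metis mult_less_mono1)
    then have "\<tau> (z 0) \<in> z ` {..<N} \<inter> (\<lambda>j. \<tau> (z j)) ` {..<N}"
      using \<tau>(3) \<open>N > 0\<close> by (metis IntI image_eqI lessThan_iff)
    moreover assume "\<forall>\<tau>\<in>Gal_rat K. \<tau> \<noteq> (\<lambda>x\<in>K. x) \<longrightarrow>
              z ` {..<N} \<inter> (\<lambda>j. \<tau> (z j)) ` {..<N} = {}"
    ultimately show False
      using \<tau> by blast
  next
    assume "\<not> (\<forall>\<tau>\<in>Gal_rat K. \<tau> \<noteq> (\<lambda>x\<in>K. x) \<longrightarrow>
              z ` {..<N} \<inter> (\<lambda>j. \<tau> (z j)) ` {..<N} = {})"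
    then obtain \<tau> i j where \<tau>: "\<tau> \<in> Gal_rat K" "\<tau> \<noteq> (\<lambda>x\<in>K. x)"
      and ij: "i < N" "j < N" "z i = \<tau> (z j)"
      by auto
    \<comment> \<open>This is \<open>i - j\<close> modulo \<open>N\<close>, written so that
      subtraction does not truncate: \<open>N - j\<close> iterations lead from \<open>z j\<close>
      round to \<open>z 0\<close>.\<close>
    define k where "k = (N - j + i) mod N"
    have k: "k < N"
      using \<open>N > 0\<close> by (simp add: k_def)
    obtain Q where Q: "\<And>w :: 'a. rat_poly_eval Q w = (?f ^^ (N - j)) w"
      using quad_map_funpow_is_rat_poly by blast
    have "z 0 = (?f ^^ (N - j)) (z j)"
      using forward[OF ij(2), of "N - j"] fN ij(2) by simp
    then have "\<tau> (z 0) = (?f ^^ (N - j)) (\<tau> (z j))"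
      using Gal_rat_eval[OF \<tau>(1) sub fin, of "z j" Q] assms(6) ij(2) Q by simp
    also have "\<dots> = (?f ^^ (N - j + i)) (z 0)"
      using forward[OF ij(1)] ij(3) by simp
    also have "\<dots> = (?f ^^ k) (z 0)"
      unfolding k_def by (rule funpow_mod_eq[OF fN, symmetric])
    finally have \<tau>z: "\<tau> (z 0) = (?f ^^ k) (z 0)" .
    have z0: "z 0 \<in> K"
      using assms(1,6) by blast
    \<comment> \<open>An automorphism sends roots of \<open>p\<close> to roots of \<open>p\<close>;
      the instance at the zero polynomial supplies \<open>\<tau> 0 = 0\<close>.\<close>
    have "rat_poly_eval p ((?f ^^ k) (z 0)) = 0" if "rat_poly_eval p (z 0) = 0" for p
      using Gal_rat_eval[OF \<tau>(1) sub fin z0, of p] Gal_rat_eval[OF \<tau>(1) sub fin z0, of 0]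
        that \<tau>z by simp
    then have "N dvd k * d"
      unfolding assms(3) by (rule period_dvd_mult_rat_degree[OF assms(2) z0 \<open>N > 0\<close> ex])
    \<comment> \<open>Since \<open>N\<close> divides \<open>k * N\<close> trivially,
      \<open>d\<close> can be replaced by \<open>g\<close>, and then \<open>g\<close> cancels
      against \<open>N = g * (N div g)\<close>.\<close>
    then have "N dvd gcd (k * N) (k * d)"
      by simp
    then have "N dvd k * g"
      by (simp add: assms(4) gcd_mult_distrib_nat)
    then have "g * (N div g) dvd g * k"
      using g(2) by (simp add: mult.commute)
    then have "N div g dvd k"
      using g(1) by simp
    then obtain m where m: "k = m * (N div g)"
      by (metis dvdE mult.commute)
    have "m < g"
    proof (rule ccontr)
      assume "\<not> m < g"
      then have "g * (N div g) \<le> m * (N div g)"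
        by (intro mult_le_mono1) simp
      then show False
        using k m g(2) by simp
    qed
    moreover have "z (m * (N div g)) = \<tau> (z 0)"
      using \<tau>z zj[OF k] m by simp
    ultimately show "\<exists>m<g. \<exists>\<tau>\<in>Gal_rat K. \<tau> \<noteq> (\<lambda>x\<in>K. x) \<and> z (m * (N div g)) = \<tau> (z 0)"
      using \<tau> by blast
  qed
qed

end
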